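(* Let $v\in\mathbb N$ with $v\ge 2$, and let $E\subseteq[0,1]$ be a closed set with $\dim_{\mathbb F}(E)>\frac{2}{v+1}$; i.e., there exist some $\beta>\frac1{v+1}$, a probability measure $\mu$ supported on $E$ and some positive constant $C$ such that $$|\widehat\mu(\xi)|\le C(1+|\xi|)^{-\beta}\quad\text{for all }\xi\in\mathbb R.$$ Then $E$ contains a nontrivial zero of some $f\in\mathcal F_v(\mathbb N)$. In other words, there exist $m_0,m_1,\ldots,m_v\in\mathbb N$ satisfying $m_0=\sum_{i=1}^v m_i$ such that $E$ contains a nontrivial solution of the equation $\sum_{i=1}^v m_ix_i=m_0x_0$, that is, there are pairwise distinct points $x_0,x_1,\ldots,x_v\in E$ satisfying this equation.
   Context: $\mathbb N=\{1,2,\ldots\}$. The Fourier transform of a measure $\mu$ is $\widehat\mu(\xi)=\int e^{-ix\xi}\,d\mu(x)$. The Fourier dimension $\dim_{\mathbb F}(A)$ of a Borel set $A\subseteq\mathbb R$ is the supremum of exponents $\beta\le 1$ for which there exist a probability measure $\mu$ supported on $A$ and a finite constant $C_2>0$ with $|\widehat\mu(\xi)|\le C_2(1+|\xi|)^{-\beta/2}$ for all $\xi\in\mathbb R$. For $v\ge2$, $\mathcal F_v(\mathbb N)$ is the set of functions $f(x_0,\ldots,x_v)=m_0x_0-\sum_{i=1}^v m_ix_i$ with $m_0,\ldots,m_v\in\mathbb N$, $m_0=\sum_{i=1}^v m_i$ and $\gcd(m_0,m_1,\ldots,m_v)=1$. A zero $x=(x_0,\ldots,x_v)\in\mathbb R^{v+1}$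 of $f$ (i.e. $f(x)=0$) is nontrivial if its entries are all distinct. $E$ contains a nontrivial zero of $f$ if some $x\in E^{v+1}$ is a nontrivial zero of $f$. *)

theory Defs
  imports "HOL-Probability.Probability"
begin

text \<open>The library's \<^const>\<open>char\<close> has the opposite sign in the exponent.\<close>

definition fourier_transform :: "real measure \<Rightarrow> real \<Rightarrow> complex" where
  "fourier_transform \<mu> \<xi> = (CLINT x|\<mu>. exp (- (\<i> * complex_of_real (x * \<xi>))))"

text \<open>
  A Borel probability measure on the line is a \<^locale>\<open>real_distribution\<close>. It is
  supported on a Borel set \<open>A\<close> when \<open>\<mu>(A) = 1\<close>; for closed \<open>A\<close> this says that the
  topological support lies in \<open>A\<close>.
\<close>

definition supported_on :: "real measure \<Rightarrow> real set \<Rightarrow> bool" where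
  "supported_on \<mu> A \<longleftrightarrow> A \<in> sets \<mu> \<and> measure \<mu> A = 1"

text \<open>
  The supremum is taken in the extended reals since the empty set carries no probability
  measure, so that no exponent is admissible for it and its dimension is \<open>-\<infinity>\<close>.
\<close>

definition fourier_dim :: "real set \<Rightarrow> ereal" where
  "fourier_dim A = Sup {ereal \<beta> | \<beta>. \<beta> \<le> 1 \<and>
     (\<exists>\<mu> C. real_distribution \<mu> \<and> supported_on \<mu> A \<and> C > 0 \<and>
        (\<forall>\<xi>. norm (fourier_transform \<mu> \<xi>) \<le> C * (1 + \<bar>\<xi>\<bar>) powr (- \<beta> / 2)))}"

text \<open>
  A point \<open>(x\<^sub>0, \<dots>, x\<^sub>v)\<close> is encoded as a function on \<open>nat\<close> of which only the values at
  \<open>0, \<dots>, v\<close> matter.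
\<close>

definition linear_forms :: "nat \<Rightarrow> ((nat \<Rightarrow> real) \<Rightarrow> real) set" where
  "linear_forms v = {f. \<exists>m :: nat \<Rightarrow> nat.
     (\<forall>i\<le>v. m i \<ge> 1) \<and> m 0 = (\<Sum>i=1..v. m i) \<and> Gcd (m ` {0..v}) = 1 \<and>
     f = (\<lambda>x. real (m 0) * x 0 - (\<Sum>i=1..v. real (m i) * x i))}"

definition nontrivial_zero :: "nat \<Rightarrow> ((nat \<Rightarrow> real) \<Rightarrow> real) \<Rightarrow> (nat \<Rightarrow> real) \<Rightarrow> bool" where
  "nontrivial_zero v f x \<longleftrightarrow> f x = 0 \<and> inj_on x {0..v}"

definition contains_nontrivial_zero ::
    "nat \<Rightarrow> real set \<Rightarrow> ((nat \<Rightarrow> real) \<Rightarrow> real) \<Rightarrow> bool" where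
  "contains_nontrivial_zero v E f \<longleftrightarrow> (\<exists>x \<in> {0..v} \<rightarrow> E. nontrivial_zero v f x)"

end

theory Submission
  imports Defs "HOL-Real_Asymp.Real_Asymp"
begin

text \<open>
  Let \<open>\<mu>\<close> be the given measure. For \<open>0 < t < 1\<close> put
  \<open>F\<^sub>t(x) = x\<^sub>0 - (1 - t) (x\<^sub>1 + \<dots> + x\<^bsub>v-1\<^esub>) / (v - 1) - t x\<^sub>v\<close>; for rational \<open>t\<close> a multiple of
  \<open>F\<^sub>t\<close> is a form with natural coefficients. The law of \<open>F\<^sub>t\<close> under \<open>\<mu>\<^bsup>v+1\<^esup>\<close>, weighted by the
  trigonometric polynomial \<open>W(x) = \<Prod>\<^bsub>i\<noteq>j\<^esub> (1 - cos (x\<^sub>i - x\<^sub>j))\<close>, has Fourier transform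
  \<open>O((1 + |\<xi>|) powr (-\<beta> (v + 1)))\<close>, which is integrable, uniformly for \<open>t\<close> away from 0 and 1. Hence
  the Gaussian averages \<open>J\<^sub>s(t) = s \<integral> W exp (-(s F\<^sub>t)\<^sup>2 / 2) d\<mu>\<^bsup>v+1\<^esup>\<close> converge as \<open>s \<rightarrow> \<infinity>\<close>, uniformly
  in \<open>t\<close>. If \<open>F\<^sub>t\<close> has no zero with distinct coordinates in \<open>E\<close>, the limit is 0 because \<open>W\<close>
  vanishes on all diagonals. If this holds for every rational \<open>t\<close>, then
  \<open>(1/N) \<Sum>\<^sub>k J\<^sub>N(k/N) \<rightarrow> 0\<close>. But on a box of positive measure \<open>F\<^sub>t(x)\<close> vanishes for some
  \<open>t = t(x)\<close> inside \<open>(0,1)\<close>, and the term with \<open>k/N\<close> next to \<open>t(x)\<close> bounds this mean from below.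
\<close>

section \<open>Decaying envelopes and Gaussian averages\<close>

text \<open>Multiplying by a cosine moves each frequency by at most 1. Such a move costs only a
  constant factor, since 1 + |y| <= 2 (1 + |x|).\<close>

lemma one_plus_abs_powr_shift:
  fixes x y \<beta> :: real
  assumes "\<bar>x - y\<bar> \<le> 1" "\<beta> \<ge> 0"
  shows "(1 + \<bar>x\<bar>) powr (-\<beta>) \<le> 2 powr \<beta> * (1 + \<bar>y\<bar>) powr (-\<beta>)"
proof -
  have "(1 + \<bar>x\<bar>) powr (-\<beta>) \<le> ((1 + \<bar>y\<bar>) / 2) powr (-\<beta>)"
    using assms by (intro powr_mono2') auto
  also have "\<dots> = 2 powr \<beta> * (1 + \<bar>y\<bar>) powr (-\<beta>)"
    by (simp add: powr_divide powr_minus field_simps)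
  finally show ?thesis .
qed

lemma one_plus_abs_powr_scale:
  fixes p x c \<beta> :: real
  assumes "c \<le> \<bar>p\<bar>" "0 < c" "c \<le> 1" "\<beta> \<ge> 0"
  shows "(1 + \<bar>p * x\<bar>) powr (-\<beta>) \<le> c powr (-\<beta>) * (1 + \<bar>x\<bar>) powr (-\<beta>)"
proof -
  have "c * \<bar>x\<bar> \<le> \<bar>p\<bar> * \<bar>x\<bar>"
    using assms by (intro mult_right_mono) auto
  then have "c * (1 + \<bar>x\<bar>) \<le> 1 + \<bar>p * x\<bar>"
    using assms(3) by (simp add: algebra_simps abs_mult)
  then have "(1 + \<bar>p * x\<bar>) powr (-\<beta>) \<le> (c * (1 + \<bar>x\<bar>)) powr (-\<beta>)"
    using assms by (intro powr_mono2') auto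
  then show ?thesis
    using assms by (simp add: powr_mult)
qed

lemma integrable_one_plus_abs_powr:
  fixes \<gamma> :: real
  assumes "\<gamma> > 1"
  shows "integrable lborel (\<lambda>x. (1 + \<bar>x\<bar>) powr (-\<gamma>))"
proof -
  let ?g = "\<lambda>x::real. indicator {0..} x * (1 + \<bar>x\<bar>) powr (-\<gamma>)"
  have lim: "((\<lambda>x. - ((1 + x) powr (1 - \<gamma>) / (\<gamma> - 1))) \<longlongrightarrow> - (0 / (\<gamma> - 1))) at_top"
    using assms
    by (intro tendsto_intros tendsto_neg_powr filterlim_tendsto_add_at_top[OF tendsto_const filterlim_ident]) auto
  have "(\<integral>\<^sup>+x. ennreal ((1 + \<bar>x\<bar>) powr (-\<gamma>)) * indicator {0..} x \<partial>lborel)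
      = ennreal (- (0 / (\<gamma> - 1)) - - ((1 + 0) powr (1 - \<gamma>) / (\<gamma> - 1)))"
  proof (rule nn_integral_FTC_atLeast[OF _ _ _ lim])
    fix x :: real assume "0 \<le> x"
    then show "((\<lambda>x. - ((1 + x) powr (1 - \<gamma>) / (\<gamma> - 1))) has_real_derivative (1 + \<bar>x\<bar>) powr (-\<gamma>)) (at x)"
      using assms by (auto intro!: derivative_eq_intros simp: divide_simps) (simp add: algebra_simps)
  qed auto
  then have half: "integrable lborel ?g"
    by (intro integrableI_nonneg) (auto simp: ennreal_mult' ennreal_indicator mult.commute)
  \<comment> \<open>The half-line and its reflection overlap at 0, so their sum only dominates the
    integrand.\<close>
  have "integrable lborel (\<lambda>x. ?g x + ?g (0 + (-1) * x))"
    by (intro Bochner_Integration.integrable_add half lborel_integrable_real_affine) auto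
  then show ?thesis
    by (rule Bochner_Integration.integrable_bound)
      (auto simp: indicator_def)
qed

text \<open>The Gaussian factor is the characteristic function of the standard normal law at
  \<open>s * F x\<close>; Fubini then moves the normal variable outside.\<close>

lemma (in prob_space) gaussian_average:
  fixes w F :: "'a \<Rightarrow> real" and B s :: real
  assumes [measurable]: "w \<in> borel_measurable M" "F \<in> borel_measurable M"
    and B: "\<And>x. x \<in> space M \<Longrightarrow> \<bar>w x\<bar> \<le> B"
  shows "complex_of_real (expectation (\<lambda>x. w x * exp (- (s * F x)\<^sup>2 / 2)))
    = (CLINT z|lborel. std_normal_density z * (CLINT x|M. w x * iexp (s * z * F x)))"
proof -
  let ?N = "density lborel (\<lambda>x. ennreal (std_normal_density x))"
  interpret N: prob_space ?N
    by (rule prob_space_normal_density) simp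
  interpret pair_sigma_finite ?N M ..
  interpret Q: pair_prob_space ?N M ..
  let ?h = "\<lambda>z x. w x * iexp (s * z * F x)"
  have int: "integrable (?N \<Otimes>\<^sub>M M) (case_prod ?h)"
    by (rule Q.P.integrable_const_bound[where B=B])
       (use B in \<open>auto simp: norm_mult space_pair_measure\<close>)
  have "complex_of_real (expectation (\<lambda>x. w x * exp (- (s * F x)\<^sup>2 / 2)))
      = (CLINT x|M. w x * char ?N (s * F x))"
    by (simp add: char_std_normal_distribution flip: of_real_mult integral_complex_of_real)
  also have "\<dots> = (CLINT x|M. CLINT z|?N. ?h z x)"
    unfolding char_def by (simp add: mult_ac)
  also have "\<dots> = (CLINT z|?N. CLINT x|M. ?h z x)"
    by (rule Fubini_integral[OF int])
  also have "\<dots> = (CLINT z|lborel. std_normal_density z *\<^sub>R (CLINT x|M. ?h z x))"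
    by (subst integral_density) auto
  finally show ?thesis
    by (simp add: scaleR_conv_of_real)
qed

text \<open>Substituting \<xi> = s z uses up the factor \<open>s\<close> as Jacobian: a bump of
  width 1/s in \<open>F\<close> becomes a cutoff at frequencies of order s.\<close>

lemma (in prob_space) gaussian_average_scaled:
  fixes w F :: "'a \<Rightarrow> real" and B s :: real
  assumes [measurable]: "w \<in> borel_measurable M" "F \<in> borel_measurable M"
    and B: "\<And>x. x \<in> space M \<Longrightarrow> \<bar>w x\<bar> \<le> B" and s: "s > 0"
  shows "complex_of_real (s * expectation (\<lambda>x. w x * exp (- (s * F x)\<^sup>2 / 2)))
    = (CLINT \<xi>|lborel. std_normal_density (\<xi> / s) * (CLINT x|M. w x * iexp (\<xi> * F x)))"
proof -
  have "(CLINT \<xi>|lborel. std_normal_density (\<xi> / s) * (CLINT x|M. w x * iexp (\<xi> * F x)))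
      = \<bar>s\<bar> *\<^sub>R (CLINT z|lborel. std_normal_density ((0 + s * z) / s) * (CLINT x|M. w x * iexp ((0 + s * z) * F x)))"
    using s by (intro lborel_integral_real_affine) auto
  also have "\<dots> = s *\<^sub>R complex_of_real (expectation (\<lambda>x. w x * exp (- (s * F x)\<^sup>2 / 2)))"
    using s by (subst gaussian_average[OF assms(1-3)]) (auto simp: mult_ac)
  finally show ?thesis by (simp add: scaleR_conv_of_real)
qed

text \<open>Every Gaussian bump centred at \<open>a\<close> dominates the indicator of
  \<open>{a}\<close>, and on the frequency side the decay forces the integrals of narrowing bumps to
  0.\<close>

lemma (in real_distribution) measure_singleton_eq_0:
  fixes C \<beta> :: real
  assumes "\<beta> > 0" and decay: "\<And>t. norm (char M t) \<le> C * (1 + \<bar>t\<bar>) powr (-\<beta>)"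
  shows "measure M {a} = 0"
proof -
  let ?f = "\<lambda>n z. std_normal_density z * (CLINT x|M. complex_of_real 1 * iexp (real n * z * (x - a)))"
  have f_eq: "(CLINT x|M. complex_of_real 1 * iexp (t * (x - a))) = iexp (- t * a) * char M t" for t
    unfolding char_def
    by (subst integral_mult_right_zero[symmetric]) (simp add: algebra_simps exp_diff exp_minus field_simps)
  have "(\<lambda>n. CLINT z|lborel. ?f n z) \<longlonglongrightarrow> integral\<^sup>L lborel (\<lambda>z::real. 0)"
  proof (rule integral_dominated_convergence[where s="?f" and w=std_normal_density])
    show "AE z in lborel. (\<lambda>n. ?f n z) \<longlonglongrightarrow> 0"
    \<comment> \<open>At z = 0 the integrand does not depend on n, so this null set is removed
      first.\<close>
    proof (rule AE_mp[OF AE_lborel_singleton[of 0]], intro AE_I2 impI)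
      fix z :: real assume "z \<noteq> 0"
      then have *: "filterlim (\<lambda>n. 1 + \<bar>z\<bar> * real n) at_top sequentially"
        by (intro filterlim_tendsto_add_at_top[OF tendsto_const] filterlim_tendsto_pos_mult_at_top[OF tendsto_const]
              filterlim_real_sequentially) auto
      have "(\<lambda>n. std_normal_density z * (C * (1 + \<bar>z\<bar> * real n) powr (-\<beta>))) \<longlonglongrightarrow> std_normal_density z * (C * 0)"
        using assms(1) by (intro tendsto_intros tendsto_neg_powr *) auto
      then have "(\<lambda>n. std_normal_density z * (C * (1 + \<bar>z\<bar> * real n) powr (-\<beta>))) \<longlonglongrightarrow> 0"
        by simp
      moreover have "norm (?f n z) \<le> std_normal_density z * (C * (1 + \<bar>z\<bar> * real n) powr (-\<beta>))" for n
      proof -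
        have "norm (?f n z) = std_normal_density z * norm (char M (real n * z))"
          unfolding f_eq by (simp add: norm_mult)
        also have "\<dots> \<le> std_normal_density z * (C * (1 + \<bar>real n * z\<bar>) powr (-\<beta>))"
          by (intro mult_left_mono decay) simp
        finally show ?thesis
          by (simp only: abs_mult abs_of_nat mult.commute[of "real n"])
      qed
      ultimately show "(\<lambda>n. ?f n z) \<longlonglongrightarrow> 0"
        by (intro Lim_null_comparison[of "\<lambda>n. ?f n z"] always_eventually allI)
    qed
    show "AE z in lborel. norm (?f n z) \<le> std_normal_density z" for n
    proof (intro AE_I2)
      fix z
      have "norm (?f n z) = std_normal_density z * norm (char M (real n * z))"
        unfolding f_eq by (simp add: norm_mult)
      also have "\<dots> \<le> std_normal_density z"
        by (intro mult_left_le cmod_char_le_1) simp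
      finally show "norm (?f n z) \<le> std_normal_density z" .
    qed
  qed (auto intro: integrable_normal_density)
  also have "(\<lambda>n. CLINT z|lborel. ?f n z)
      = (\<lambda>n. complex_of_real (expectation (\<lambda>x. 1 * exp (- (real n * (x - a))\<^sup>2 / 2))))"
    by (rule ext, rule gaussian_average[symmetric, where B=1]) auto
  finally have "(\<lambda>n. complex_of_real (expectation (\<lambda>x. 1 * exp (- (real n * (x - a))\<^sup>2 / 2)))) \<longlonglongrightarrow> of_real 0"
    by (simp only: integral_zero of_real_0)
  then have lim: "(\<lambda>n. expectation (\<lambda>x. 1 * exp (- (real n * (x - a))\<^sup>2 / 2))) \<longlonglongrightarrow> 0"
    by (simp only: tendsto_of_real_iff)
  have "measure M {a} \<le> expectation (\<lambda>x. 1 * exp (- (real n * (x - a))\<^sup>2 / 2))" for n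
  proof -
    have "measure M {a} = expectation (indicator {a})" by simp
    also have "\<dots> \<le> expectation (\<lambda>x. 1 * exp (- (real n * (x - a))\<^sup>2 / 2))"
      by (intro integral_mono integrable_const_bound[where B=1]) (auto simp: indicator_def)
    finally show ?thesis .
  qed
  then have "measure M {a} \<le> 0"
    by (intro LIMSEQ_le_const[OF lim]) auto
  then show ?thesis by (simp add: measure_le_0_iff)
qed

lemma std_normal_density_le_0: "std_normal_density x \<le> std_normal_density 0"
  by (simp add: std_normal_density_def divide_le_cancel)

lemma std_normal_density_0_le_1: "std_normal_density 0 \<le> 1"
proof -
  have "1 \<le> sqrt (2 * pi)"
    using pi_ge_two by (intro real_le_rsqrt) auto
  then show ?thesis by (simp add: std_normal_density_def)
qed

lemma std_normal_density_anti:
  assumes "\<bar>x\<bar> \<le> \<bar>y\<bar>"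
  shows "std_normal_density y \<le> std_normal_density x"
  using assms by (simp add: std_normal_density_def divide_right_mono abs_le_square_iff)

section \<open>Separated pieces of an atomless distribution\<close>

lemma (in real_distribution) cdf_surj:
  assumes atomless: "\<And>x. measure M {x} = 0" and y: "0 < y" "y < 1"
  obtains x where "cdf M x = y"
proof -
  have "\<forall>\<^sub>F x in at_bot. cdf M x < y"
    using cdf_lim_at_bot y(1) by (rule order_tendstoD)
  from eventually_happens'[OF trivial_limit_at_bot_linorder this]
  obtain a where a: "cdf M a < y" by (rule exE)
  have "\<forall>\<^sub>F x in at_top. y < cdf M x"
    using cdf_lim_at_top_prob y(2) by (rule order_tendstoD)
  from eventually_happens'[OF trivial_limit_at_top_linorder this]
  obtain b where b: "y < cdf M b" by (rule exE)
  have "a \<le> b"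
  proof (rule ccontr)
    assume "\<not> a \<le> b"
    then have "cdf M b \<le> cdf M a"
      by (intro cdf_nondecreasing) simp
    with a b show False by linarith
  qed
  moreover have "\<forall>x. a \<le> x \<and> x \<le> b \<longrightarrow> isCont (cdf M) x"
    by (simp add: isCont_cdf atomless)
  ultimately have "\<exists>x. a \<le> x \<and> x \<le> b \<and> cdf M x = y"
    by (rule IVT[of "cdf M" a y b, OF less_imp_le[OF a] less_imp_le[OF b]])
  then show ?thesis using that by (elim exE conjE)
qed

text \<open>Quantiles cut out intervals of equal positive measure; every second one is kept, and the
  skipped ones serve as gaps.\<close>

lemma (in real_distribution) separated_pieces:
  assumes atomless: "\<And>x. measure M {x} = 0" and E: "E \<in> sets borel" "measure M E = 1"
  obtains J :: "nat \<Rightarrow> real set" and g :: real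
  where "0 < g" "g \<le> 1" "\<And>k. J k \<in> sets borel" "\<And>k. J k \<subseteq> E" "\<And>k. k \<le> n \<Longrightarrow> measure M (J k) > 0"
    "\<And>k l x y. k < l \<Longrightarrow> l \<le> n \<Longrightarrow> x \<in> J k \<Longrightarrow> y \<in> J l \<Longrightarrow> x + g \<le> y"
proof -
  \<comment> \<open>The points \<open>a 0\<close>, ..., \<open>a (2 * n + 1)\<close> bound n + 1
    pieces and the n gaps between them.\<close>
  define m where "m = 2 * n + 1"
  have "\<exists>x. cdf M x = real (k + 1) / real (m + 2)" if "k \<le> m" for k
  proof -
    have "0 < real (k + 1) / real (m + 2)" "real (k + 1) / real (m + 2) < 1"
      using that by auto
    from cdf_surj[OF atomless this] show ?thesis
      by blast
  qed
  then obtain a where a: "\<And>k. k \<le> m \<Longrightarrow> cdf M (a k) = real (k + 1) / real (m + 2)"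
    by metis
  have a_less: "a k < a l" if "k < l" "l \<le> m" for k l
  proof (rule ccontr)
    assume "\<not> a k < a l"
    then have "cdf M (a l) \<le> cdf M (a k)"
      by (intro cdf_nondecreasing) auto
    then show False
      using that a[of k] a[of l] by (simp add: divide_le_cancel)
  qed
  define g where "g = Min (insert 1 ((\<lambda>k. a (Suc k) - a k) ` {..<m}))"
  have g: "0 < g" "g \<le> 1" "\<And>k. k < m \<Longrightarrow> g \<le> a (Suc k) - a k"
    unfolding g_def using a_less by auto
  define J where "J = (\<lambda>k. {a (2 * k)<..a (Suc (2 * k))} \<inter> E)"
  show ?thesis
  proof (rule that[of g J])
    fix k assume "k \<le> n"
    then have "2 * k < Suc (2 * k)" "Suc (2 * k) \<le> m"
      by (auto simp: m_def)
    then have "measure M {a (2 * k)<..a (Suc (2 * k))} = cdf M (a (Suc (2 * k))) - cdf M (a (2 * k))"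
      using cdf_diff_eq a_less by metis
    also have "\<dots> > 0"
      using \<open>Suc (2 * k) \<le> m\<close> by (simp add: a divide_strict_right_mono)
    \<comment> \<open>Cutting down to \<open>E\<close> loses no mass because \<open>E\<close> has
      full measure.\<close>
    also have "measure M {a (2 * k)<..a (Suc (2 * k))} = measure M (J k)"
    proof (rule finite_measure_eq_AE)
      have "AE y in M. y \<in> E"
        using E by (intro AE_prob_1) auto
      then show "AE x in M. x \<in> {a (2 * k)<..a (Suc (2 * k))} \<longleftrightarrow> x \<in> J k"
        by eventually_elim (auto simp: J_def)
    qed (use E in \<open>auto simp: J_def\<close>)
    finally show "measure M (J k) > 0" .
  next
    fix k l x y assume kl: "k < l" "l \<le> n" and xy: "x \<in> J k" "y \<in> J l"
    have "a (Suc (Suc (2 * k))) \<le> a (2 * l)"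
      using a_less[of "Suc (Suc (2 * k))" "2 * l"] kl by (cases "Suc (Suc (2 * k)) = 2 * l") (auto simp: m_def)
    moreover have "g \<le> a (Suc (Suc (2 * k))) - a (Suc (2 * k))"
      using kl by (intro g(3)) (auto simp: m_def)
    ultimately show "x + g \<le> y"
      using xy by (auto simp: J_def)
  qed (use g(1,2) E in \<open>auto simp: J_def\<close>)
qed

section \<open>Weights on the product measure\<close>

text \<open>\<open>beta_large\<close> makes the product of v + 1 decay factors, taken at frequencies
  proportional to one variable, integrable on the line.\<close>

locale fourier_decay = real_distribution M for M :: "real measure" +
  fixes v :: nat and \<beta> C :: real
  assumes beta_large: "\<beta> * real (Suc v) > 1" and C_pos: "C > 0"
    and decay: "\<And>t. norm (char M t) \<le> C * (1 + \<bar>t\<bar>) powr (-\<beta>)"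
begin

lemma beta_pos: "\<beta> > 0"
  using beta_large by (intro zero_less_mult_pos2[of \<beta> "real (Suc v)"]) auto

abbreviation Q :: "(nat \<Rightarrow> real) measure" where
  "Q \<equiv> Pi\<^sub>M {..v} (\<lambda>_. M)"

abbreviation lin :: "(nat \<Rightarrow> real) \<Rightarrow> (nat \<Rightarrow> real) \<Rightarrow> real" where
  "lin p x \<equiv> (\<Sum>i\<le>v. p i * x i)"

sublocale Q: finite_product_prob_space "\<lambda>_::nat. M" "{..v}"
  by standard auto

lemma measurable_coord: "i \<le> v \<Longrightarrow> (\<lambda>x. x i) \<in> borel_measurable Q"
  using measurable_component_singleton[of i "{..v}" "\<lambda>_. M"] measurable_cong_sets[OF refl events_eq_borel, of Q] by auto

lemma measurable_lin [measurable]: "lin p \<in> borel_measurable Q"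
  by (intro borel_measurable_sum borel_measurable_times measurable_coord) auto

text \<open>Keeping one factor per coordinate makes the condition stable under frequency shifts, and
  it can be restricted to any line of frequencies with nonzero direction entries.\<close>

definition has_decay :: "((nat \<Rightarrow> real) \<Rightarrow> real) \<Rightarrow> real \<Rightarrow> bool" where
  "has_decay w K \<longleftrightarrow> (\<forall>\<xi>. norm (CLINT x|Q. w x * iexp (lin \<xi> x)) \<le> K * (\<Prod>i\<le>v. (1 + \<bar>\<xi> i\<bar>) powr (-\<beta>)))"

text \<open>The exponential factorises over the coordinates, so its integral is a product of
  characteristic functions.\<close>

lemma has_decay_1: "has_decay (\<lambda>_. 1) (C ^ Suc v)"
  unfolding has_decay_def
proof
  fix \<xi> :: "nat \<Rightarrow> real"
  have "(CLINT x|Q. complex_of_real 1 * iexp (lin \<xi> x)) = (CLINT x|Q. (\<Prod>i\<le>v. iexp (\<xi> i * x i)))"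
    by (simp add: exp_sum sum_distrib_left)
  also have "\<dots> = (\<Prod>i\<le>v. char M (\<xi> i))"
    unfolding char_def
    by (rule Q.product_integral_prod) (auto intro!: integrable_const_bound[where B=1])
  also have "norm \<dots> \<le> (\<Prod>i\<le>v. C * (1 + \<bar>\<xi> i\<bar>) powr (-\<beta>))"
    unfolding prod_norm[symmetric] by (intro prod_mono conjI decay norm_ge_zero)
  finally show "norm (CLINT x|Q. complex_of_real 1 * iexp (lin \<xi> x))
      \<le> C ^ Suc v * (\<Prod>i\<le>v. (1 + \<bar>\<xi> i\<bar>) powr (-\<beta>))"
    by (simp add: prod.distrib)
qed

lemma prod_powr_shift:
  assumes "\<And>i. \<bar>\<eta> i - \<xi> i\<bar> \<le> 1"
  shows "(\<Prod>i\<le>v. (1 + \<bar>\<eta> i\<bar>) powr (-\<beta>)) \<le> (2 powr \<beta>) ^ Suc v * (\<Prod>i\<le>v. (1 + \<bar>\<xi> i\<bar>) powr (-\<beta>))"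
proof -
  have "(\<Prod>i\<le>v. (1 + \<bar>\<eta> i\<bar>) powr (-\<beta>)) \<le> (\<Prod>i\<le>v. 2 powr \<beta> * (1 + \<bar>\<xi> i\<bar>) powr (-\<beta>))"
    using assms beta_pos by (intro prod_mono conjI one_plus_abs_powr_shift) auto
  then show ?thesis by (simp add: prod.distrib)
qed

text \<open>The new factor is a trigonometric polynomial: the transform becomes that of
  \<open>w\<close> at \<xi> minus the mean of its values at two shifted frequencies, each entry
  moving by at most 1.\<close>

lemma has_decay_mult:
  assumes [measurable]: "w \<in> borel_measurable Q" and B: "\<And>x. \<bar>w x\<bar> \<le> B"
    and w: "has_decay w K" and K: "K \<ge> 0" and ij: "i \<le> v" "j \<le> v"
  shows "has_decay (\<lambda>x. (1 - cos (x i - x j)) * w x) (K * (1 + (2 powr \<beta>) ^ Suc v))"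
  unfolding has_decay_def
proof
  fix \<xi> :: "nat \<Rightarrow> real"
  \<comment> \<open>The shift along the difference of the i-th and j-th unit vectors; for i = j the
    two changes cancel.\<close>
  define sh where "sh = (\<lambda>(s::real) k. \<xi> k + s * (of_bool (k = i) - of_bool (k = j)))"
  define D where "D = (\<Prod>i\<le>v. (1 + \<bar>\<xi> i\<bar>) powr (-\<beta>))"
  have lin_sh: "lin (sh s) x = lin \<xi> x + s * (x i - x j)" for s x
  proof -
    have "lin (sh s) x = lin \<xi> x + s * ((\<Sum>k\<le>v. x k * of_bool (k = i)) - (\<Sum>k\<le>v. x k * of_bool (k = j)))"
    proof -
      have "lin (sh s) x = (\<Sum>k\<le>v. \<xi> k * x k + s * (x k * of_bool (k = i) - x k * of_bool (k = j)))"
        unfolding sh_def by (intro sum.cong refl) (simp only: algebra_simps)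
      then show ?thesis
        by (simp only: sum.distrib sum_subtractf sum_distrib_left[symmetric])
    qed
    also have "(\<Sum>k\<le>v. x k * of_bool (k = i)) = x i"
      using ij by (subst sum_mult_of_bool_eq) auto
    also have "(\<Sum>k\<le>v. x k * of_bool (k = j)) = x j"
      using ij by (subst sum_mult_of_bool_eq) auto
    finally show ?thesis .
  qed
  have int: "integrable Q (\<lambda>x. w x * iexp (lin \<eta> x))" for \<eta>
    by (rule Q.integrable_const_bound[where B=B]) (use B in \<open>auto simp: norm_mult\<close>)
  have triangle: "norm (a - (b + c) / 2) \<le> norm a + (norm b + norm c) / 2" for a b c :: complex
    by (rule norm_triangle_le_diff) (simp add: norm_divide norm_triangle_ineq)
  let ?I = "\<lambda>\<eta>. CLINT x|Q. w x * iexp (lin \<eta> x)"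
  have "complex_of_real ((1 - cos (x i - x j)) * w x) * iexp (lin \<xi> x)
      = w x * iexp (lin \<xi> x) - (w x * iexp (lin (sh 1) x) + w x * iexp (lin (sh (-1)) x)) / 2" for x
  proof -
    have "complex_of_real (cos (x i - x j)) = (iexp (x i - x j) + iexp (- (x i - x j))) / 2"
      by (simp add: cos_of_real[symmetric] cos_exp_eq algebra_simps)
    have "iexp (lin (sh s) x) = iexp (lin \<xi> x) * iexp (s * (x i - x j))" for s
      unfolding lin_sh by (simp add: exp_add[symmetric] ring_distribs)
    then have "iexp (lin (sh 1) x) + iexp (lin (sh (-1)) x) = 2 * complex_of_real (cos (x i - x j)) * iexp (lin \<xi> x)"
      unfolding \<open>complex_of_real (cos (x i - x j)) = _\<close> by (simp only:) (simp add: algebra_simps)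
    then have "(w x * iexp (lin (sh 1) x) + w x * iexp (lin (sh (-1)) x)) / 2
        = w x * complex_of_real (cos (x i - x j)) * iexp (lin \<xi> x)"
      by (simp only: distrib_left[symmetric]) simp
    then show ?thesis
      by (simp only:) (simp add: algebra_simps)
  qed
  then have "(CLINT x|Q. complex_of_real ((1 - cos (x i - x j)) * w x) * iexp (lin \<xi> x))
      = (CLINT x|Q. w x * iexp (lin \<xi> x) - (w x * iexp (lin (sh 1) x) + w x * iexp (lin (sh (-1)) x)) / 2)"
    by presburger
  also have "\<dots> = ?I \<xi> - (?I (sh 1) + ?I (sh (-1))) / 2"
    using int by simp
  finally have "norm (CLINT x|Q. complex_of_real ((1 - cos (x i - x j)) * w x) * iexp (lin \<xi> x))
      \<le> norm (?I \<xi>) + (norm (?I (sh 1)) + norm (?I (sh (-1)))) / 2"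
    by (simp only: triangle)
  also have "\<dots> \<le> K * D + (K * ((2 powr \<beta>) ^ Suc v * D) + K * ((2 powr \<beta>) ^ Suc v * D)) / 2"
  proof -
    have "norm (?I (sh s)) \<le> K * ((2 powr \<beta>) ^ Suc v * D)" if "\<bar>s\<bar> \<le> 1" for s
    proof -
      have "norm (?I (sh s)) \<le> K * (\<Prod>i\<le>v. (1 + \<bar>sh s i\<bar>) powr (-\<beta>))"
        using w unfolding has_decay_def by blast
      also have "\<dots> \<le> K * ((2 powr \<beta>) ^ Suc v * D)"
        unfolding D_def by (intro mult_left_mono K prod_powr_shift) (use that in \<open>auto simp: sh_def\<close>)
      finally show ?thesis .
    qed
    moreover have "norm (?I \<xi>) \<le> K * D"
      using w unfolding has_decay_def D_def by blast
    ultimately show ?thesis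
      by (intro add_mono divide_right_mono) simp_all
  qed
  also have "\<dots> = K * (1 + (2 powr \<beta>) ^ Suc v) * D"
    by (simp add: algebra_simps)
  finally show "norm (CLINT x|Q. complex_of_real ((1 - cos (x i - x j)) * w x) * iexp (lin \<xi> x))
      \<le> K * (1 + (2 powr \<beta>) ^ Suc v) * (\<Prod>i\<le>v. (1 + \<bar>\<xi> i\<bar>) powr (-\<beta>))"
    unfolding D_def .
qed

text \<open>The set of pairs is a parameter so that decay can be proved by adding one factor at a
  time.\<close>

definition weight :: "(nat \<times> nat) set \<Rightarrow> (nat \<Rightarrow> real) \<Rightarrow> real" where
  "weight A x = (\<Prod>(i, j)\<in>A. 1 - cos (x i - x j))"

lemma weight_nonneg: "weight A x \<ge> 0"
  unfolding weight_def by (intro prod_nonneg) auto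

lemma weight_le: "weight A x \<le> 2 ^ card A"
proof -
  have "weight A x \<le> (\<Prod>_\<in>A. 2)"
    unfolding weight_def
  proof (intro prod_mono, safe)
    show "1 - cos (x i - x j) \<le> 2" for i j
      using cos_ge_minus_one[of "x i - x j"] by linarith
  qed auto
  then show ?thesis by simp
qed

lemma abs_weight_le: "\<bar>weight A x\<bar> \<le> 2 ^ card A"
  using weight_nonneg weight_le by (simp add: abs_of_nonneg)

lemma measurable_weight: "A \<subseteq> {..v} \<times> {..v} \<Longrightarrow> weight A \<in> borel_measurable Q"
  unfolding weight_def split_def
proof (intro borel_measurable_prod)
  fix q assume "A \<subseteq> {..v} \<times> {..v}" "q \<in> A"
  then have "fst q \<le> v" "snd q \<le> v" by auto
  then have "(\<lambda>x. x (fst q) - x (snd q)) \<in> borel_measurable Q"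
    by (rule borel_measurable_diff[OF measurable_coord measurable_coord])
  then have "(\<lambda>x. cos (x (fst q) - x (snd q))) \<in> borel_measurable Q"
    by (rule measurable_compose[OF _ borel_measurable_cos])
  then show "(\<lambda>x. 1 - cos (x (fst q) - x (snd q))) \<in> borel_measurable Q"
    by (rule borel_measurable_diff[OF borel_measurable_const])
qed

lemma has_decay_weight:
  assumes "finite A" "A \<subseteq> {..v} \<times> {..v}"
  shows "has_decay (weight A) (C ^ Suc v * (1 + (2 powr \<beta>) ^ Suc v) ^ card A)"
  using assms
proof (induction A rule: finite_induct)
  case empty
  have "weight {} = (\<lambda>_. 1)" by (simp add: weight_def[abs_def])
  then show ?case using has_decay_1 by (simp only: card.empty power_0 mult_1_right)
next
  case (insert q A)
  obtain i j where q: "q = (i, j)" by (cases q)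
  have eq: "weight (insert q A) = (\<lambda>x. (1 - cos (x i - x j)) * weight A x)"
    using insert by (simp add: weight_def[abs_def] q)
  let ?K = "C ^ Suc v * (1 + (2 powr \<beta>) ^ Suc v) ^ card A"
  have "?K \<ge> 0"
    using C_pos by (intro mult_nonneg_nonneg zero_le_power add_nonneg_nonneg) auto
  then have "has_decay (weight (insert q A)) (?K * (1 + (2 powr \<beta>) ^ Suc v))"
    unfolding eq using insert.prems insert.IH
    by (intro has_decay_mult[where B="2 ^ card A"] measurable_weight abs_weight_le) (simp_all add: q)
  moreover have "?K * (1 + (2 powr \<beta>) ^ Suc v) = C ^ Suc v * (1 + (2 powr \<beta>) ^ Suc v) ^ card (insert q A)"
    using insert.hyps by (metis card_insert_disjoint mult.assoc power_Suc2)
  ultimately show ?case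
    by (simp only:)
qed

section \<open>Smoothed densities at zero\<close>

text \<open>Up to the factor sqrt (2 pi), this is the density at 0 of the \<open>w\<close>-weighted
  law of \<open>lin p\<close>, convolved with a centred normal law of standard deviation
  1/s.\<close>

definition smoothed :: "((nat \<Rightarrow> real) \<Rightarrow> real) \<Rightarrow> (nat \<Rightarrow> real) \<Rightarrow> real \<Rightarrow> real" where
  "smoothed w p s = s * (LINT x|Q. w x * exp (- (s * lin p x)\<^sup>2 / 2))"

definition envelope :: "real \<Rightarrow> real" where
  "envelope \<xi> = (1 + \<bar>\<xi>\<bar>) powr (- (\<beta> * real (Suc v)))"

lemma envelope_nonneg [simp]: "envelope \<xi> \<ge> 0"
  unfolding envelope_def by simp

lemma integrable_envelope: "integrable lborel envelope"
  unfolding envelope_def[abs_def] by (rule integrable_one_plus_abs_powr[OF beta_large])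

lemma measurable_envelope [measurable]: "envelope \<in> borel_measurable borel"
  unfolding envelope_def[abs_def] by measurable

text \<open>The cost of the frequency cutoff at scale \<open>s\<close>. It involves neither
  \<open>w\<close> nor \<open>p\<close>, which gives uniformity in the coefficients.\<close>

definition defect :: "real \<Rightarrow> real" where
  "defect s = (LINT \<xi>|lborel. (std_normal_density 0 - std_normal_density (\<xi> / s)) * envelope \<xi>)"

lemma defect_nonneg: "defect s \<ge> 0"
  unfolding defect_def
  by (intro integral_nonneg_AE AE_I2 mult_nonneg_nonneg) (auto simp: std_normal_density_le_0)

lemma integrable_defect:
  "integrable lborel (\<lambda>\<xi>. (std_normal_density 0 - std_normal_density (\<xi> / s)) * envelope \<xi>)"
proof (rule Bochner_Integration.integrable_bound[OF integrable_envelope])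
  show "AE \<xi> in lborel. norm ((std_normal_density 0 - std_normal_density (\<xi> / s)) * envelope \<xi>) \<le> norm (envelope \<xi>)"
  proof (intro AE_I2)
    fix \<xi>
    have "\<bar>std_normal_density 0 - std_normal_density (\<xi> / s)\<bar> \<le> 1"
      using std_normal_density_le_0[of "\<xi> / s"] std_normal_density_0_le_1 normal_density_nonneg[of 0 1 "\<xi> / s"]
      by linarith
    then show "norm ((std_normal_density 0 - std_normal_density (\<xi> / s)) * envelope \<xi>) \<le> norm (envelope \<xi>)"
      by (simp add: abs_mult mult_left_le_one_le)
  qed
qed measurable

text \<open>\<open>has_decay\<close> is evaluated at the frequencies \<open>p i * \<xi>\<close>,
  each of size at least c |\<xi>|, so the v + 1 factors merge into the envelope.\<close>

lemma fourier_lin_bound: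
  assumes "has_decay w K" "K \<ge> 0" and p: "\<And>i. i \<le> v \<Longrightarrow> c \<le> \<bar>p i\<bar>" and c: "0 < c" "c \<le> 1"
  shows "norm (CLINT x|Q. w x * iexp (\<xi> * lin p x)) \<le> K * (c powr (-\<beta>)) ^ Suc v * envelope \<xi>"
proof -
  have "norm (CLINT x|Q. w x * iexp (lin (\<lambda>i. p i * \<xi>) x)) \<le> K * (\<Prod>i\<le>v. (1 + \<bar>p i * \<xi>\<bar>) powr (-\<beta>))"
    by (rule spec[OF assms(1)[unfolded has_decay_def], of "\<lambda>i. p i * \<xi>"])
  also have "\<dots> \<le> K * (\<Prod>i\<le>v. c powr (-\<beta>) * (1 + \<bar>\<xi>\<bar>) powr (-\<beta>))"
    using assms beta_pos by (intro mult_left_mono prod_mono conjI one_plus_abs_powr_scale) auto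
  also have "\<dots> = K * (c powr (-\<beta>)) ^ Suc v * envelope \<xi>"
    by (simp add: envelope_def power_mult_distrib powr_power mult.assoc algebra_simps del: power_Suc)
  finally show ?thesis
    by (simp add: sum_distrib_left mult_ac)
qed

text \<open>The bounds below depend on \<open>p\<close> only through the lower bound
  \<open>c\<close>, hence hold uniformly over a family of linear forms.\<close>

context
  fixes w :: "(nat \<Rightarrow> real) \<Rightarrow> real" and B K c :: real and p :: "nat \<Rightarrow> real"
  assumes w [measurable]: "w \<in> borel_measurable Q" and B: "\<And>x. \<bar>w x\<bar> \<le> B"
    and K: "has_decay w K" "K \<ge> 0"
    and p: "\<And>i. i \<le> v \<Longrightarrow> c \<le> \<bar>p i\<bar>" and c: "0 < c" "c \<le> 1"
begin

lemma smoothed_eq: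
  assumes "s > 0"
  shows "complex_of_real (smoothed w p s)
    = (CLINT \<xi>|lborel. std_normal_density (\<xi> / s) * (CLINT x|Q. w x * iexp (\<xi> * lin p x)))"
  unfolding smoothed_def
  by (rule Q.gaussian_average_scaled[OF w measurable_lin B assms])

lemma norm_integrand_le:
  "norm (std_normal_density (\<xi> / s) * (CLINT x|Q. w x * iexp (\<xi> * lin p x)))
    \<le> K * (c powr (-\<beta>)) ^ Suc v * envelope \<xi>"
proof -
  let ?I = "CLINT x|Q. w x * iexp (\<xi> * lin p x)"
  have "norm (std_normal_density (\<xi> / s) * ?I) = std_normal_density (\<xi> / s) * norm ?I"
    by (simp add: norm_mult)
  also have "\<dots> \<le> 1 * norm ?I"
    by (intro mult_right_mono order_trans[OF std_normal_density_le_0 std_normal_density_0_le_1]) simp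
  also have "\<dots> \<le> K * (c powr (-\<beta>)) ^ Suc v * envelope \<xi>"
    using fourier_lin_bound[OF K p c, where \<xi>=\<xi>] by simp
  finally show ?thesis .
qed

lemma integrable_fourier_lin:
  "integrable lborel (\<lambda>\<xi>. std_normal_density (\<xi> / s) * (CLINT x|Q. w x * iexp (\<xi> * lin p x)))"
proof (rule Bochner_Integration.integrable_bound)
  show "integrable lborel (\<lambda>\<xi>. K * (c powr (-\<beta>)) ^ Suc v * envelope \<xi>)"
    by (intro integrable_mult_right integrable_envelope)
  show "AE \<xi> in lborel. norm (std_normal_density (\<xi> / s) * (CLINT x|Q. w x * iexp (\<xi> * lin p x)))
      \<le> norm (K * (c powr (-\<beta>)) ^ Suc v * envelope \<xi>)"
    by (intro AE_I2 order_trans[OF norm_integrand_le]) (simp only: real_norm_def abs_ge_self)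
qed measurable

lemma smoothed_le:
  assumes "s > 0"
  shows "smoothed w p s \<le> K * (c powr (-\<beta>)) ^ Suc v * integral\<^sup>L lborel envelope"
proof -
  have "smoothed w p s \<le> norm (complex_of_real (smoothed w p s))"
    by simp
  also have "\<dots> \<le> (LINT \<xi>|lborel. K * (c powr (-\<beta>)) ^ Suc v * envelope \<xi>)"
    unfolding smoothed_eq[OF assms]
    by (rule Bochner_Integration.integral_norm_bound_integral)
       (intro integrable_fourier_lin integrable_mult_right integrable_envelope norm_integrand_le)+
  finally show ?thesis by simp
qed

text \<open>The cutoff increases pointwise with the scale towards its value at 0, so passing from
  \<open>s\<close> to any finer scale costs at most \<open>defect s\<close>. This replaces a
  comparison with the limit.\<close>

lemma smoothed_diff_le:
  assumes s: "0 < s" "s \<le> s'"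
  shows "smoothed w p s \<le> smoothed w p s' + K * (c powr (-\<beta>)) ^ Suc v * defect s"
proof -
  have "smoothed w p s - smoothed w p s' \<le> norm (complex_of_real (smoothed w p s) - complex_of_real (smoothed w p s'))"
    by (simp flip: of_real_diff)
  also have "complex_of_real (smoothed w p s) - complex_of_real (smoothed w p s') = (CLINT \<xi>|lborel.
      std_normal_density (\<xi> / s) * (CLINT x|Q. w x * iexp (\<xi> * lin p x))
      - std_normal_density (\<xi> / s') * (CLINT x|Q. w x * iexp (\<xi> * lin p x)))"
    using s smoothed_eq[of s] smoothed_eq[of s']
    by (simp only: Bochner_Integration.integral_diff[OF integrable_fourier_lin integrable_fourier_lin] order.strict_trans2)
  also have "norm \<dots> \<le> (LINT \<xi>|lborel. K * (c powr (-\<beta>)) ^ Suc v * ((std_normal_density 0 - std_normal_density (\<xi> / s)) * envelope \<xi>))"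
  proof (rule Bochner_Integration.integral_norm_bound_integral)
    fix \<xi>
    let ?I = "CLINT x|Q. w x * iexp (\<xi> * lin p x)"
    have "std_normal_density (\<xi> / s) \<le> std_normal_density (\<xi> / s')"
      using s by (intro std_normal_density_anti) (simp add: frac_le)
    then have *: "\<bar>std_normal_density (\<xi> / s) - std_normal_density (\<xi> / s')\<bar> \<le> std_normal_density 0 - std_normal_density (\<xi> / s)"
      using std_normal_density_le_0[of "\<xi> / s'"] by linarith
    have "norm (std_normal_density (\<xi> / s) * ?I - std_normal_density (\<xi> / s') * ?I)
        = \<bar>std_normal_density (\<xi> / s) - std_normal_density (\<xi> / s')\<bar> * norm ?I"
      by (simp only: left_diff_distrib[symmetric] of_real_diff[symmetric] norm_mult norm_of_real)
    also have "\<dots> \<le> (std_normal_density 0 - std_normal_density (\<xi> / s)) * (K * (c powr (-\<beta>)) ^ Suc v * envelope \<xi>)"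
      using * fourier_lin_bound[OF K p c] std_normal_density_le_0[of "\<xi> / s"] by (intro mult_mono) auto
    also have "\<dots> = K * (c powr (-\<beta>)) ^ Suc v * ((std_normal_density 0 - std_normal_density (\<xi> / s)) * envelope \<xi>)"
      by (simp only: mult_ac)
    finally show "norm (std_normal_density (\<xi> / s) * ?I - std_normal_density (\<xi> / s') * ?I)
        \<le> K * (c powr (-\<beta>)) ^ Suc v * ((std_normal_density 0 - std_normal_density (\<xi> / s)) * envelope \<xi>)" .
  qed (intro Bochner_Integration.integrable_diff integrable_fourier_lin integrable_mult_right integrable_defect)+
  also have "\<dots> = K * (c powr (-\<beta>)) ^ Suc v * defect s"
    unfolding defect_def by simp
  finally show ?thesis by simp
qed

end

lemma defect_tendsto_0: "(\<lambda>n. defect (real n)) \<longlonglongrightarrow> 0"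
proof -
  let ?f = "\<lambda>n \<xi>. (std_normal_density 0 - std_normal_density (\<xi> / real n)) * envelope \<xi>"
  have "(\<lambda>n. integral\<^sup>L lborel (?f n)) \<longlonglongrightarrow> integral\<^sup>L lborel (\<lambda>\<xi>::real. 0)"
  proof (rule integral_dominated_convergence[where s="?f" and w=envelope])
    show "AE \<xi> in lborel. (\<lambda>n. ?f n \<xi>) \<longlonglongrightarrow> 0"
    proof (intro AE_I2)
      fix \<xi> :: real
      have "(\<lambda>n. \<xi> / real n) \<longlonglongrightarrow> 0"
        by (rule lim_const_over_n)
      then have "(\<lambda>n. std_normal_density (\<xi> / real n)) \<longlonglongrightarrow> std_normal_density 0"
        unfolding std_normal_density_def by (intro tendsto_intros) auto
      then have "(\<lambda>n. ?f n \<xi>) \<longlonglongrightarrow> (std_normal_density 0 - std_normal_density 0) * envelope \<xi>"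
        by (intro tendsto_intros)
      then show "(\<lambda>n. ?f n \<xi>) \<longlonglongrightarrow> 0" by simp
    qed
    show "AE \<xi> in lborel. norm (?f n \<xi>) \<le> envelope \<xi>" for n
    proof (intro AE_I2)
      fix \<xi>
      have "\<bar>std_normal_density 0 - std_normal_density (\<xi> / real n)\<bar> \<le> 1"
        using std_normal_density_le_0[of "\<xi> / n"] std_normal_density_0_le_1 normal_density_nonneg[of 0 1 "\<xi> / n"]
        by linarith
      then show "norm (?f n \<xi>) \<le> envelope \<xi>"
        by (simp add: abs_mult mult_left_le_one_le)
    qed
  qed (auto intro: integrable_envelope)
  then show ?thesis by (simp add: defect_def)
qed

section \<open>Separation from the diagonals\<close>

abbreviation off_diagonal :: "(nat \<times> nat) set" where
  "off_diagonal \<equiv> {q \<in> {..v} \<times> {..v}. fst q \<noteq> snd q}"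

lemma weight_off_diagonal_eq_0:
  assumes "\<not> inj_on x {..v}"
  shows "weight off_diagonal x = 0"
proof -
  obtain i j where "i \<le> v" "j \<le> v" "i \<noteq> j" "x i = x j"
    using assms by (auto simp: inj_on_def)
  then have "(i, j) \<in> off_diagonal" "(case (i, j) of (i, j) \<Rightarrow> 1 - cos (x i - x j)) = 0"
    by auto
  then show ?thesis
    unfolding weight_def by (intro prod_zero) (auto simp: finite_subset[of _ "{..v} \<times> {..v}"])
qed

text \<open>Extensionality fixes all coordinates beyond \<open>v\<close> at
  \<open>undefined\<close>, so the set is a full product of compact sets and Tychonoff
  applies.\<close>

lemma compact_PiE_coords:
  assumes "compact (E :: real set)"
  shows "compact (PiE {..v} (\<lambda>_. E))"
proof -
  have eq: "PiE {..v} (\<lambda>_. E) = PiE UNIV (\<lambda>i. if i \<le> v then E else {undefined})"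
    by (auto simp: PiE_iff extensional_def split: if_splits)
  have "compactin (product_topology (\<lambda>_::nat. euclidean) UNIV) (PiE UNIV (\<lambda>i. if i \<le> v then E else {undefined :: real}))"
    using assms by (subst compactin_PiE) auto
  then show ?thesis
    unfolding eq by (simp add: euclidean_product_topology)
qed

lemma continuous_on_weight: "continuous_on S (weight A)"
  unfolding weight_def[abs_def] split_def
  by (intro continuous_intros continuous_on_subset[OF continuous_on_product_coordinates subset_UNIV])

lemma continuous_on_lin: "continuous_on S (lin p)"
  by (intro continuous_intros continuous_on_subset[OF continuous_on_product_coordinates subset_UNIV])

text \<open>On the compact part of the product where the weight is at least \<open>e\<close>, all
  coordinates are distinct, so |lin p| has no zero there and attains a positive minimum.\<close>

lemma lin_bounded_away:
  assumes "compact E" "e > 0" and free: "\<And>x. x \<in> PiE {..v} (\<lambda>_. E) \<Longrightarrow> inj_on x {..v} \<Longrightarrow> lin p x \<noteq> 0"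
  obtains d where "d > 0"
    "\<And>x. x \<in> PiE {..v} (\<lambda>_. E) \<Longrightarrow> e \<le> weight off_diagonal x \<Longrightarrow> d \<le> \<bar>lin p x\<bar>"
proof -
  let ?S = "PiE {..v} (\<lambda>_. E) \<inter> {x. e \<le> weight off_diagonal x}"
  show ?thesis
  proof (cases "?S = {}")
    case True
    show ?thesis by (rule that[of 1]) (use True in auto)
  next
    case False
    have "compact ?S"
      by (intro compact_Int_closed compact_PiE_coords assms closed_Collect_le continuous_on_weight continuous_on_const)
    from continuous_attains_inf[OF this False continuous_on_rabs[OF continuous_on_lin]]
    obtain x where x: "x \<in> ?S" "\<forall>y\<in>?S. \<bar>lin p x\<bar> \<le> \<bar>lin p y\<bar>"
      by (rule bexE)
    have "inj_on x {..v}"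
      using x(1) assms(2) weight_off_diagonal_eq_0[of x] by force
    then have "lin p x \<noteq> 0"
      using free x(1) by blast
    then show ?thesis
      using x by (intro that[of "\<bar>lin p x\<bar>"]) auto
  qed
qed

lemma AE_Q_PiE:
  assumes "E \<in> sets borel" "measure M E = 1"
  shows "AE x in Q. x \<in> PiE {..v} (\<lambda>_. E)"
proof -
  have "AE y in M. y \<in> E"
    using assms by (intro AE_prob_1) auto
  then have "AE x in Q. \<forall>i\<in>{..v}. x i \<in> E"
    by (intro AE_finite_allI) (auto intro: Q.AE_component)
  then show ?thesis
    by (rule AE_mp) (auto intro!: AE_I2 simp: space_PiM PiE_iff)
qed

lemma integrable_gaussian_weight:
  assumes "w \<in> borel_measurable Q" "\<And>x. \<bar>w x\<bar> \<le> B"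
  shows "integrable Q (\<lambda>x. w x * exp (- (s * lin p x)\<^sup>2 / 2))"
proof (rule Q.integrable_const_bound[where B=B])
  show "AE x in Q. norm (w x * exp (- (s * lin p x)\<^sup>2 / 2)) \<le> B"
    using assms(2) by (intro AE_I2) (auto simp: abs_mult intro!: order_trans[OF mult_right_le_one_le])
qed (use assms(1) in measurable)

text \<open>Where the weight is below \<open>e\<close>, it is replaced by \<open>e\<close>;
  elsewhere |lin p| >= d and the Gaussian is small. The first part is an unweighted average, bounded
  independently of the scale.\<close>

lemma smoothed_weight_split:
  assumes E: "compact E" "measure M E = 1" and "e > 0"
    and free: "\<And>x. x \<in> PiE {..v} (\<lambda>_. E) \<Longrightarrow> inj_on x {..v} \<Longrightarrow> lin p x \<noteq> 0"
  obtains d where "d > 0"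
    "\<And>s. s > 0 \<Longrightarrow> smoothed (weight off_diagonal) p s
      \<le> e * smoothed (\<lambda>_. 1) p s + 2 ^ card off_diagonal * (s * exp (- (s * d)\<^sup>2 / 2))"
proof -
  obtain d where d: "d > 0"
    "\<And>x. x \<in> PiE {..v} (\<lambda>_. E) \<Longrightarrow> e \<le> weight off_diagonal x \<Longrightarrow> d \<le> \<bar>lin p x\<bar>"
    using lin_bounded_away[OF E(1) \<open>e > 0\<close> free] by blast
  have AE_PiE: "AE x in Q. x \<in> PiE {..v} (\<lambda>_. E)"
    using E by (intro AE_Q_PiE) (auto dest: compact_imp_closed)
  have W: "weight off_diagonal \<in> borel_measurable Q"
    by (intro measurable_weight) auto
  show ?thesis
  proof (rule that[OF d(1)])
    fix s :: real assume s: "s > 0"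
    let ?g = "\<lambda>x. exp (- (s * lin p x)\<^sup>2 / 2)"
    have "(LINT x|Q. weight off_diagonal x * ?g x)
        \<le> (LINT x|Q. e * (1 * ?g x) + 2 ^ card off_diagonal * exp (- (s * d)\<^sup>2 / 2))"
    proof (rule integral_mono_AE)
      show "integrable Q (\<lambda>x. weight off_diagonal x * ?g x)"
        by (rule integrable_gaussian_weight[OF W abs_weight_le])
      show "integrable Q (\<lambda>x. e * (1 * ?g x) + 2 ^ card off_diagonal * exp (- (s * d)\<^sup>2 / 2))"
        by (intro Bochner_Integration.integrable_add integrable_mult_right integrable_gaussian_weight[where B=1] Q.integrable_const) auto
      show "AE x in Q. weight off_diagonal x * ?g x \<le> e * (1 * ?g x) + 2 ^ card off_diagonal * exp (- (s * d)\<^sup>2 / 2)"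
      proof (rule AE_mp[OF AE_PiE], intro AE_I2 impI)
        fix x assume x: "x \<in> PiE {..v} (\<lambda>_. E)"
        show "weight off_diagonal x * ?g x \<le> e * (1 * ?g x) + 2 ^ card off_diagonal * exp (- (s * d)\<^sup>2 / 2)"
        proof (cases "e \<le> weight off_diagonal x")
          case True
          then have "(s * d)\<^sup>2 \<le> (s * lin p x)\<^sup>2"
            using d(1) d(2)[OF x] s unfolding abs_le_square_iff[symmetric] by (simp add: abs_mult)
          then have "weight off_diagonal x * ?g x \<le> 2 ^ card off_diagonal * exp (- (s * d)\<^sup>2 / 2)"
            using weight_le weight_nonneg by (intro mult_mono) auto
          moreover have "0 \<le> e * (1 * ?g x)"
            using \<open>e > 0\<close> by simp
          ultimately show ?thesis by linarith
        next
          case False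
          then have "weight off_diagonal x * ?g x \<le> e * ?g x"
            by (intro mult_right_mono) auto
          moreover have "0 \<le> 2 ^ card off_diagonal * exp (- (s * d)\<^sup>2 / 2)"
            by simp
          ultimately show ?thesis by linarith
        qed
      qed
    qed
    also have "\<dots> = e * (LINT x|Q. 1 * ?g x) + 2 ^ card off_diagonal * exp (- (s * d)\<^sup>2 / 2)"
      using integrable_gaussian_weight[where B=1 and w="\<lambda>_. 1" and s=s and p=p]
      by (simp add: Q.P.prob_space)
    finally have "(LINT x|Q. weight off_diagonal x * ?g x)
      \<le> e * (LINT x|Q. 1 * ?g x) + 2 ^ card off_diagonal * exp (- (s * d)\<^sup>2 / 2)" .
    from mult_left_mono[OF this, of s] s
    show "smoothed (weight off_diagonal) p s
      \<le> e * smoothed (\<lambda>_. 1) p s + 2 ^ card off_diagonal * (s * exp (- (s * d)\<^sup>2 / 2))"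
      unfolding smoothed_def by (simp add: algebra_simps)
  qed
qed

section \<open>Small weighted density in the absence of zeros\<close>

definition decay_const :: real where
  "decay_const = C ^ Suc v * (1 + (2 powr \<beta>) ^ Suc v) ^ card off_diagonal"

lemma decay_const_nonneg: "decay_const \<ge> 0"
  unfolding decay_const_def using C_pos by (intro mult_nonneg_nonneg zero_le_power add_nonneg_nonneg) auto

lemma has_decay_off_diagonal: "has_decay (weight off_diagonal) decay_const"
  unfolding decay_const_def by (intro has_decay_weight) (auto simp: finite_subset[of _ "{..v} \<times> {..v}"])

text \<open>By the splitting, the weighted average at a very fine scale s' is at most \<eta>;
  \<open>smoothed_diff_le\<close> carries this back to the given scale.\<close>

lemma smoothed_le_defect:
  assumes E: "compact E" "measure M E = 1" and p: "\<And>i. i \<le> v \<Longrightarrow> c \<le> \<bar>p i\<bar>" and c: "0 < c" "c \<le> 1"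
    and free: "\<And>x. x \<in> PiE {..v} (\<lambda>_. E) \<Longrightarrow> inj_on x {..v} \<Longrightarrow> lin p x \<noteq> 0"
    and s: "s > 0"
  shows "smoothed (weight off_diagonal) p s \<le> decay_const * (c powr (-\<beta>)) ^ Suc v * defect s"
proof (rule field_le_epsilon)
  fix \<eta> :: real assume \<eta>: "\<eta> > 0"
  define L where "L = C ^ Suc v * (c powr (-\<beta>)) ^ Suc v * integral\<^sup>L lborel envelope"
  have L: "L \<ge> 0"
    unfolding L_def using C_pos by (intro mult_nonneg_nonneg integral_nonneg_AE) auto
  \<comment> \<open>\<open>L\<close> bounds the unweighted average at every scale, so the part of
    small weight contributes at most \<eta>/2; L + 1 avoids division by zero.\<close>
  define e where "e = \<eta> / (2 * (L + 1))"
  have e: "e > 0" "e * L \<le> \<eta> / 2"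
    using \<eta> L by (auto simp: e_def field_simps)
  obtain d where d: "d > 0" "\<And>s. s > 0 \<Longrightarrow> smoothed (weight off_diagonal) p s
      \<le> e * smoothed (\<lambda>_. 1) p s + 2 ^ card off_diagonal * (s * exp (- (s * d)\<^sup>2 / 2))"
    using smoothed_weight_split[OF E e(1) free] by blast
  have "((\<lambda>s. s * exp (- (s * d)\<^sup>2 / 2)) \<longlongrightarrow> 0) at_top"
    using d(1) by real_asymp
  then have "((\<lambda>s. 2 ^ card off_diagonal * (s * exp (- (s * d)\<^sup>2 / 2))) \<longlongrightarrow> 0) at_top"
    by (rule tendsto_mult_right_zero)
  then have "\<forall>\<^sub>F s in at_top. 2 ^ card off_diagonal * (s * exp (- (s * d)\<^sup>2 / 2)) < \<eta> / 2"
    using \<eta> by (intro order_tendstoD) auto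
  moreover have "\<forall>\<^sub>F s' in at_top. s \<le> s'"
    by (rule eventually_ge_at_top)
  ultimately have "\<forall>\<^sub>F s' in at_top. s \<le> s' \<and> 2 ^ card off_diagonal * (s' * exp (- (s' * d)\<^sup>2 / 2)) < \<eta> / 2"
    by eventually_elim auto
  then obtain s' where s': "s \<le> s'" "2 ^ card off_diagonal * (s' * exp (- (s' * d)\<^sup>2 / 2)) < \<eta> / 2"
    using eventually_happens'[OF trivial_limit_at_top_linorder] by blast
  have "smoothed (\<lambda>_. 1) p s' \<le> L"
    unfolding L_def
    by (rule smoothed_le[where B=1, OF _ _ has_decay_1 _ p c]) (use C_pos s s' in auto)
  then have "e * smoothed (\<lambda>_. 1) p s' \<le> \<eta> / 2"
    using e mult_left_mono[of "smoothed (\<lambda>_. 1) p s'" L e] by linarith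
  then have "smoothed (weight off_diagonal) p s' \<le> \<eta>"
    using d(2)[of s'] s s' by linarith
  moreover have "smoothed (weight off_diagonal) p s
      \<le> smoothed (weight off_diagonal) p s' + decay_const * (c powr (-\<beta>)) ^ Suc v * defect s"
    by (rule smoothed_diff_le[OF _ abs_weight_le has_decay_off_diagonal decay_const_nonneg p c s s'(1)])
       (auto intro: measurable_weight)
  ultimately show "smoothed (weight off_diagonal) p s \<le> decay_const * (c powr (-\<beta>)) ^ Suc v * defect s + \<eta>"
    by linarith
qed

section \<open>Zeros with rational coefficients\<close>

text \<open>For \<open>t = k / N\<close> the multiples of these coefficients by \<open>N (v - 1)\<close> are integers.\<close>

definition coeff :: "real \<Rightarrow> nat \<Rightarrow> real" where
  "coeff t i = (if i = 0 then 1 else if i = v then - t else - ((1 - t) / (real v - 1)))"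

lemma lin_coeff:
  assumes "v \<ge> 2"
  shows "lin (coeff t) x = x 0 - (1 - t) * ((\<Sum>i=1..<v. x i) / (real v - 1)) - t * x v"
proof -
  have "{..v} = insert 0 (insert v {1..<v})"
    using assms by auto
  then have "lin (coeff t) x = x 0 - t * x v + (\<Sum>i=1..<v. coeff t i * x i)"
    using assms by (simp add: coeff_def)
  also have "(\<Sum>i=1..<v. coeff t i * x i) = (\<Sum>i=1..<v. - ((1 - t) / (real v - 1)) * x i)"
    by (intro sum.cong) (auto simp: coeff_def)
  also have "\<dots> = - ((1 - t) / (real v - 1)) * (\<Sum>i=1..<v. x i)"
    by (rule sum_distrib_left[symmetric])
  finally show ?thesis by simp
qed

text \<open>The mass 1 - t >= g/2 is shared among v - 1 coordinates, each receiving at least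
  (g/2)/v; the other two coefficients are at least g/2 in modulus.\<close>

lemma coeff_bound:
  assumes "v \<ge> 2" "g \<le> 1" "g / 2 \<le> t" "t \<le> 1 - g / 2" "0 < g" "i \<le> v"
  shows "g / (2 * real v) \<le> \<bar>coeff t i\<bar>"
proof -
  have *: "g / (2 * real v) \<le> g / 2"
    using assms by (intro frac_le) auto
  have "(g / 2) / real v \<le> (1 - t) / (real v - 1)"
    using assms by (intro frac_le) auto
  moreover have "g / 2 / real v = g / (2 * real v)"
    by simp
  ultimately show ?thesis
    using * assms(1-5) by (simp add: coeff_def)
qed

text \<open>Pieces of the support numbered from left to right are distributed to the coordinates
  so that \<open>x\<^sub>1 < \<dots> < x\<^bsub>v-1\<^esub> < x\<^sub>0 < x\<^sub>v\<close>: then \<open>x\<^sub>0\<close> lies strictly between \<open>x\<^sub>v\<close> and the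
  mean of the other points.\<close>

definition slot :: "nat \<Rightarrow> nat" where
  "slot i = (if i = 0 then v - 1 else if i = v then v else i - 1)"

text \<open>Without such a zero, the sum over k of the Gaussian averages at t = k/N and scale N is
  at most a constant times \<open>defect N\<close>, while the box keeps it above a positive
  constant.\<close>

lemma rational_zero_exists:
  assumes v: "v \<ge> 2" and E: "E \<subseteq> {0..1}" "closed E" "measure M E = 1"
  obtains N k :: nat and x where "0 < k" "k < N" "x \<in> PiE {..v} (\<lambda>_. E)" "inj_on x {..v}"
    "lin (coeff (real k / real N)) x = 0"
proof (rule ccontr)
  assume contra: "\<not> thesis"
  note rational = that
  have compact: "compact E"
    using compact_Int_closed[OF compact_Icc[of "0::real" 1] E(2)] E(1) by (simp add: Int_absorb1)
  have atomless: "measure M {a} = 0" for a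
    by (rule measure_singleton_eq_0[OF beta_pos decay])
  obtain J g where g: "0 < g" "g \<le> 1" and J: "\<And>k. J k \<in> sets borel" "\<And>k. J k \<subseteq> E"
      "\<And>k. k \<le> v \<Longrightarrow> measure M (J k) > 0"
    and sep: "\<And>k l x y. k < l \<Longrightarrow> l \<le> v \<Longrightarrow> x \<in> J k \<Longrightarrow> y \<in> J l \<Longrightarrow> x + g \<le> y"
    by (rule separated_pieces[of E v, OF atomless borel_closed[OF E(2)] E(3)]) (rule that)
  define box where "box = PiE {..v} (\<lambda>i. J (slot i))"
  \<comment> \<open>On the box, coordinates differ by at least g and at most 1 < pi, so each factor
    of the weight is at least 1 - cos g.\<close>
  define \<kappa> where "\<kappa> = (1 - cos g) ^ card off_diagonal"
  define c where "c = g / (2 * real v)"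
  define D where "D = decay_const * (c powr (-\<beta>)) ^ Suc v"
  have slot_le: "slot i \<le> v" if "i \<le> v" for i
    using that by (auto simp: slot_def)
  have box_sets: "box \<in> sets Q"
    unfolding box_def using J by (intro sets_PiM_I_finite) auto
  have "measure Q box = (\<Prod>i\<le>v. measure M (J (slot i)))"
    unfolding box_def using J by (intro Q.prob_times) auto
  also have "\<dots> > 0"
    using J slot_le by (intro prod_pos) auto
  finally have box_pos: "measure Q box > 0" .
  have "cos g < cos 0"
    using g pi_gt3 by (intro cos_monotone_0_pi) auto
  then have \<kappa>: "\<kappa> > 0"
    unfolding \<kappa>_def by simp
  have c: "0 < c" "c \<le> 1"
    using g v by (auto simp: c_def field_simps)
  have D: "D \<ge> 0"
    unfolding D_def by (intro mult_nonneg_nonneg decay_const_nonneg) simp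
  have box_D: "x i \<in> J (slot i)" if "x \<in> box" "i \<le> v" for x i
    using that by (simp add: box_def PiE_iff)
  have box_range: "x i \<in> {0..1}" if "x \<in> box" "i \<le> v" for x i
    using box_D[OF that] J(2) E(1) by (meson subsetD)
  have box_sep: "x i + g \<le> x j" if "x \<in> box" "i \<le> v" "j \<le> v" "slot i < slot j" for x i j
    by (rule sep[OF that(4) slot_le[OF that(3)] box_D[OF that(1,2)] box_D[OF that(1,3)]])
  have slot_inj: "slot i \<noteq> slot j" if "i \<noteq> j" "i \<le> v" "j \<le> v" for i j
    using that v by (auto simp: slot_def split: if_splits)
  have weight_ge: "\<kappa> \<le> weight off_diagonal x" if x: "x \<in> box" for x
  proof -
    have "(\<Prod>q\<in>off_diagonal. 1 - cos g) \<le> weight off_diagonal x"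
      unfolding weight_def
    proof (intro prod_mono, safe)
      fix i j assume ij: "i \<le> v" "j \<le> v" "fst (i, j) \<noteq> snd (i, j)"
      then have "g \<le> \<bar>x i - x j\<bar>"
        using slot_inj[of i j] box_sep[OF x, of i j] box_sep[OF x, of j i] by (cases "slot i < slot j") auto
      moreover have "\<bar>x i - x j\<bar> \<le> pi"
        using box_range[OF x ij(1)] box_range[OF x ij(2)] pi_gt3 by auto
      ultimately have "cos \<bar>x i - x j\<bar> \<le> cos g"
        using g by (intro cos_monotone_0_pi_le) auto
      then show "1 - cos g \<le> 1 - cos (x i - x j)"
        by simp
    qed auto
    then show ?thesis by (simp add: \<kappa>_def)
  qed
  have bound: "\<kappa> * exp (-1/2) * measure Q box \<le> 2 * D * defect (real N)" if N: "2 / g \<le> real N" for N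
  proof -
    have N_pos: "0 < real N"
      using N g by (smt (verit) divide_pos_pos)
    \<comment> \<open>The mesh 1/N is at most g/2, so rounding a t in [g, 1 - g] down to the grid
      stays in this range, where \<open>coeff_bound\<close> applies.\<close>
    define A where "A = {k. k \<le> N \<and> g / 2 \<le> real k / real N \<and> real k / real N \<le> 1 - g / 2}"
    let ?G = "\<lambda>k x. weight off_diagonal x * exp (- (real N * lin (coeff (real k / real N)) x)\<^sup>2 / 2)"
    have fin: "finite A"
      unfolding A_def by simp
    have "card A \<le> card {..N}"
      by (intro card_mono) (auto simp: A_def)
    \<comment> \<open>N + 1 <= 2 N, as N is positive.\<close>
    then have card: "real (card A) \<le> 2 * real N"
      using N_pos by simp
    have W: "weight off_diagonal \<in> borel_measurable Q"
      by (intro measurable_weight) auto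
    have int: "integrable Q (?G k)" for k
      by (rule integrable_gaussian_weight[OF W abs_weight_le])
    have G_nonneg: "0 \<le> ?G k x" for k x
      using weight_nonneg by simp
    have pointwise: "\<kappa> * exp (-1/2) \<le> (\<Sum>k\<in>A. ?G k x)" if x: "x \<in> box" for x
    proof -
      define X where "X = (\<Sum>i=1..<v. x i) / (real v - 1)"
      have v1: "real v - 1 > 0"
        using v by simp
      have "(\<Sum>i=1..<v. x i) \<le> (\<Sum>i=1..<v. x 0 - g)"
        using box_sep[OF x, of _ 0] v by (intro sum_mono) (fastforce simp: slot_def algebra_simps)
      also have "\<dots> = (x 0 - g) * (real v - 1)"
        using v by (simp add: of_nat_diff)
      finally have X_le: "X \<le> x 0 - g"
        unfolding X_def using v1 by (simp add: divide_le_eq)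
      have X_nonneg: "0 \<le> X"
        unfolding X_def using v1 box_range[OF x] by (intro divide_nonneg_pos sum_nonneg) auto
      have xv: "x 0 + g \<le> x v" "x v \<le> 1"
        using box_sep[OF x, of 0 v] box_range[OF x, of v] v by (auto simp: slot_def)
      \<comment> \<open>The parameter at which the form vanishes at x: x 0 is the mixture of X and x
        v with weights 1 - t and t.\<close>
      define t where "t = (x 0 - X) / (x v - X)"
      have pos: "0 < x v - X" "x v - X \<le> 1"
        using X_le X_nonneg xv g by auto
      have lin_eq: "lin (coeff s) x = (x v - X) * (t - s)" for s
        unfolding lin_coeff[OF v] X_def[symmetric] using pos by (simp add: t_def field_simps)
      \<comment> \<open>The numerators x 0 - X and x v - x 0 of t and 1 - t are at least g, and the
        common denominator is at most 1.\<close>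
      have "g \<le> t"
        unfolding t_def using pos X_le xv g
        by (simp add: le_divide_eq) (smt (verit) mult_left_le)
      moreover have "1 - t = (x v - x 0) / (x v - X)"
        unfolding t_def using pos by (simp add: field_simps)
      then have "g \<le> 1 - t"
        using pos X_le xv g
        by (simp add: le_divide_eq) (smt (verit) mult_left_le)
      ultimately have t: "g \<le> t" "t \<le> 1 - g" by auto
      define k where "k = nat \<lfloor>t * real N\<rfloor>"
      have "0 \<le> t * real N"
        using t g N_pos by simp
      then have k: "real k \<le> t * real N" "t * real N < real k + 1"
        unfolding k_def by linarith+
      have "real k / real N \<le> t" "t \<le> (real k + 1) / real N"
        using k N_pos by (simp_all add: divide_le_eq le_divide_eq)
      then have kt: "0 \<le> t - real k / real N" "t - real k / real N \<le> 1 / real N"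
        by (simp_all add: add_divide_distrib)
      have N_inv: "1 / real N \<le> g / 2"
        using N g N_pos by (simp add: field_simps)
      have "real k \<le> real N"
        using k(1) t g N_pos by (smt (verit) mult_left_le_one_le)
      then have kA: "k \<in> A"
        unfolding A_def using kt t N_inv g by auto
      \<comment> \<open>The form is affine in the parameter with slope at most 1 in modulus, and k/N
        misses t by at most 1/N. Hence the Gaussian factor is at least exp (-1/2).\<close>
      have "\<bar>real N * lin (coeff (real k / real N)) x\<bar> \<le> 1"
      proof -
        have "\<bar>real N * lin (coeff (real k / real N)) x\<bar> = (x v - X) * (real N * (t - real k / real N))"
          unfolding lin_eq using pos kt N_pos by (simp add: abs_mult)
        also have "\<dots> \<le> 1 * (real N * (1 / real N))"
          using pos kt N_pos by (intro mult_mono) auto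
        finally show ?thesis using N_pos by simp
      qed
      then have "(real N * lin (coeff (real k / real N)) x)\<^sup>2 \<le> 1"
        by (simp add: abs_square_le_1)
      then have "\<kappa> * exp (-1/2) \<le> ?G k x"
        using weight_ge[OF x] \<kappa> by (intro mult_mono) auto
      also have "\<dots> \<le> (\<Sum>k\<in>A. ?G k x)"
        by (rule member_le_sum[OF kA _ fin]) (rule G_nonneg)
      finally show ?thesis .
    qed
    have "\<kappa> * exp (-1/2) * measure Q box = (LINT x|Q. indicator box x * (\<kappa> * exp (-1/2)))"
      using box_sets by simp
    also have "\<dots> \<le> (LINT x|Q. (\<Sum>k\<in>A. ?G k x))"
    proof (rule integral_mono)
      show "integrable Q (\<lambda>x. indicator box x * (\<kappa> * exp (-1/2)))"
        using box_sets by (intro integrable_mult_left integrable_real_indicator) (auto simp: Q.P.emeasure_finite less_top[symmetric])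
      show "integrable Q (\<lambda>x. \<Sum>k\<in>A. ?G k x)"
        by (intro Bochner_Integration.integrable_sum int)
      show "indicator box x * (\<kappa> * exp (-1/2)) \<le> (\<Sum>k\<in>A. ?G k x)" for x
        using pointwise[of x] sum_nonneg[of A "\<lambda>k. ?G k x"] G_nonneg by (auto simp: indicator_def)
    qed
    also have "\<dots> = (\<Sum>k\<in>A. LINT x|Q. ?G k x)"
      by (intro Bochner_Integration.integral_sum int)
    \<comment> \<open>The assumed absence of zeros enters here, with one constant D for all k in
      \<open>A\<close>; the factor 1/N offsets the number of terms.\<close>
    also have "\<dots> \<le> (\<Sum>k\<in>A. D * defect (real N) / real N)"
    proof (rule sum_mono)
      fix k assume k: "k \<in> A"
      then have "g / 2 \<le> real k / real N" "real k / real N \<le> 1 - g / 2"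
        unfolding A_def by blast+
      then have "0 < real k / real N" "real k / real N < 1"
        using g by linarith+
      then have k0: "0 < k" "k < N"
        using N_pos by (auto simp: zero_less_divide_iff)
      have "smoothed (weight off_diagonal) (coeff (real k / real N)) (real N) \<le> D * defect (real N)"
        unfolding D_def
      proof (rule smoothed_le_defect[OF compact E(3) _ c])
        show "c \<le> \<bar>coeff (real k / real N) i\<bar>" if "i \<le> v" for i
          unfolding c_def using k g v that by (intro coeff_bound) (auto simp: A_def)
        show "lin (coeff (real k / real N)) x \<noteq> 0" if "x \<in> PiE {..v} (\<lambda>_. E)" "inj_on x {..v}" for x
          using contra rational[OF k0 that] by blast
      qed (rule N_pos)
      then show "(LINT x|Q. ?G k x) \<le> D * defect (real N) / real N"
        unfolding smoothed_def using N_pos by (simp add: field_simps)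
    qed
    also have "\<dots> = real (card A) * (D * defect (real N) / real N)"
      by simp
    also have "\<dots> \<le> (2 * real N) * (D * defect (real N) / real N)"
      using card D defect_nonneg N_pos by (intro mult_right_mono) auto
    also have "\<dots> = 2 * D * defect (real N)"
      using N_pos by simp
    finally show ?thesis .
  qed
  have "(\<lambda>N. 2 * D * defect (real N)) \<longlonglongrightarrow> 2 * D * 0"
    by (intro tendsto_intros defect_tendsto_0)
  moreover have "\<forall>\<^sub>F N in sequentially. 2 / g \<le> real N"
    using filterlim_real_sequentially by (rule filterlim_at_top[THEN iffD1, rule_format])
  then have "\<forall>\<^sub>F N in sequentially. \<kappa> * exp (-1/2) * measure Q box \<le> 2 * D * defect (real N)"
    by (rule eventually_mono) (rule bound)
  ultimately have "\<kappa> * exp (-1/2) * measure Q box \<le> 2 * D * 0"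
    by (intro tendsto_lowerbound) auto
  moreover have "0 < \<kappa> * exp (-1/2) * measure Q box"
    using \<kappa> box_pos by simp
  ultimately show False by simp
qed

end

section \<open>Integer forms\<close>

lemma fourier_transform_eq_char: "fourier_transform \<mu> \<xi> = char \<mu> (- \<xi>)"
  unfolding fourier_transform_def char_def by (simp add: mult.commute)

lemma fourier_dim_greater_iff:
  assumes "v \<ge> (2 :: nat)"
  shows "fourier_dim E > ereal (2 / (real v + 1)) \<longleftrightarrow>
    (\<exists>\<beta> \<mu> C. \<beta> > 1 / (real v + 1) \<and> real_distribution \<mu> \<and> supported_on \<mu> E \<and> C > 0 \<and>
       (\<forall>\<xi>. norm (fourier_transform \<mu> \<xi>) \<le> C * (1 + \<bar>\<xi>\<bar>) powr (- \<beta>)))"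
proof
  assume "fourier_dim E > ereal (2 / (real v + 1))"
  then obtain \<beta> \<mu> C where *: "2 / (real v + 1) < \<beta>" "real_distribution \<mu>" "supported_on \<mu> E" "C > 0"
    "\<forall>\<xi>. norm (fourier_transform \<mu> \<xi>) \<le> C * (1 + \<bar>\<xi>\<bar>) powr (- \<beta> / 2)"
    unfolding fourier_dim_def less_Sup_iff by auto
  then have "1 / (real v + 1) < \<beta> / 2" "- \<beta> / 2 = - (\<beta> / 2)"
    by (auto simp: field_simps)
  with * show "\<exists>\<beta> \<mu> C. \<beta> > 1 / (real v + 1) \<and> real_distribution \<mu> \<and> supported_on \<mu> E \<and> C > 0 \<and>
       (\<forall>\<xi>. norm (fourier_transform \<mu> \<xi>) \<le> C * (1 + \<bar>\<xi>\<bar>) powr (- \<beta>))"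
    by metis
next
  assume "\<exists>\<beta> \<mu> C. \<beta> > 1 / (real v + 1) \<and> real_distribution \<mu> \<and> supported_on \<mu> E \<and> C > 0 \<and>
       (\<forall>\<xi>. norm (fourier_transform \<mu> \<xi>) \<le> C * (1 + \<bar>\<xi>\<bar>) powr (- \<beta>))"
  then obtain \<beta> \<mu> C where *: "\<beta> > 1 / (real v + 1)" "real_distribution \<mu>" "supported_on \<mu> E" "C > 0"
    and decay: "\<And>\<xi>. norm (fourier_transform \<mu> \<xi>) \<le> C * (1 + \<bar>\<xi>\<bar>) powr (- \<beta>)"
    by blast
  \<comment> \<open>The dimension halves the exponent and caps it at 1. The cap stays above the
    threshold because 2/(v + 1) < 1 for v >= 2.\<close>
  define \<beta>' where "\<beta>' = min (2 * \<beta>) 1"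
  have "\<beta>' \<le> 1"
    by (simp add: \<beta>'_def)
  have "norm (fourier_transform \<mu> \<xi>) \<le> C * (1 + \<bar>\<xi>\<bar>) powr (- \<beta>' / 2)" for \<xi>
  proof -
    have "(1 + \<bar>\<xi>\<bar>) powr (- \<beta>) \<le> (1 + \<bar>\<xi>\<bar>) powr (- \<beta>' / 2)"
      by (intro powr_mono) (auto simp: \<beta>'_def)
    then show ?thesis
      using decay[of \<xi>] \<open>C > 0\<close> by (meson mult_left_mono less_imp_le order_trans)
  qed
  then have "ereal \<beta>' \<in> {ereal \<beta> | \<beta>. \<beta> \<le> 1 \<and>
     (\<exists>\<mu> C. real_distribution \<mu> \<and> supported_on \<mu> E \<and> C > 0 \<and>
        (\<forall>\<xi>. norm (fourier_transform \<mu> \<xi>) \<le> C * (1 + \<bar>\<xi>\<bar>) powr (- \<beta> / 2)))}"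
    using * \<open>\<beta>' \<le> 1\<close> by blast
  then have "ereal \<beta>' \<le> fourier_dim E"
    unfolding fourier_dim_def by (rule Sup_upper)
  moreover have "2 / (real v + 1) < \<beta>'"
    using *(1) assms by (simp add: \<beta>'_def divide_less_eq field_simps)
  then have "ereal (2 / (real v + 1)) < ereal \<beta>'"
    by simp
  ultimately show "fourier_dim E > ereal (2 / (real v + 1))"
    by (rule less_le_trans[rotated])
qed

text \<open>Dividing the coefficients by their gcd makes them primitive while preserving positivity,
  the sum relation and the zero.\<close>

lemma linear_form_zeroI:
  fixes m :: "nat \<Rightarrow> nat" and x :: "nat \<Rightarrow> real"
  assumes m: "\<forall>i\<le>v. m i \<ge> 1" "m 0 = (\<Sum>i=1..v. m i)" and x: "\<forall>i\<le>v. x i \<in> E" "inj_on x {0..v}"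
    and zero: "(\<Sum>i=1..v. real (m i) * x i) = real (m 0) * x 0"
  shows "\<exists>f \<in> linear_forms v. contains_nontrivial_zero v E f"
proof -
  define d where "d = Gcd (m ` {0..v})"
  define m' where "m' = (\<lambda>i. m i div d)"
  have m_eq: "m i = d * m' i" if "i \<le> v" for i
    using that unfolding m'_def d_def by (auto intro!: dvd_mult_div_cancel[symmetric] Gcd_dvd)
  have d_pos: "d > 0"
    using m_eq[of 0] m(1) by (cases d) auto
  have "m ` {0..v} = (*) d ` m' ` {0..v}"
    unfolding image_image by (rule image_cong) (simp_all add: m_eq)
  \<comment> \<open>Homogeneity of the gcd: pulling out d leaves a gcd that must be 1.\<close>
  then have "d = d * Gcd (m' ` {0..v})"
    using Gcd_mult[of d "m' ` {0..v}"] by (simp add: d_def)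
  then have gcd: "Gcd (m' ` {0..v}) = 1"
    using d_pos by simp
  have pos: "\<forall>i\<le>v. m' i \<ge> 1"
    using m(1) m_eq by (metis One_nat_def Suc_leI gr0I mult_0_right not_one_le_zero)
  have "d * m' 0 = (\<Sum>i=1..v. d * m' i)"
    using m(2) m_eq by simp
  then have sum: "m' 0 = (\<Sum>i=1..v. m' i)"
    using d_pos by (simp flip: sum_distrib_left)
  let ?f = "\<lambda>x. real (m' 0) * x 0 - (\<Sum>i=1..v. real (m' i) * x i)"
  have "real d * (\<Sum>i=1..v. real (m' i) * x i) = (\<Sum>i=1..v. real (m i) * x i)"
    by (simp add: m_eq sum_distrib_left mult.assoc)
  also have "\<dots> = real d * (real (m' 0) * x 0)"
    using zero m_eq[of 0] by simp
  finally have "?f x = 0"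
    using d_pos by simp
  then have "contains_nontrivial_zero v E ?f"
    unfolding contains_nontrivial_zero_def nontrivial_zero_def using x by (intro bexI[of _ x]) auto
  moreover have "?f \<in> linear_forms v"
    unfolding linear_forms_def using pos sum gcd by blast
  ultimately show ?thesis by blast
qed

lemma (in fourier_decay) natural_solution_exists:
  assumes v: "v \<ge> 2" and E: "E \<subseteq> {0..1}" "closed E" "measure M E = 1"
  obtains m :: "nat \<Rightarrow> nat" and x :: "nat \<Rightarrow> real"
  where "\<forall>i\<le>v. m i \<ge> 1" "m 0 = (\<Sum>i=1..v. m i)" "\<forall>i\<le>v. x i \<in> E" "inj_on x {0..v}"
    "(\<Sum>i=1..v. real (m i) * x i) = real (m 0) * x 0"
proof -
  obtain N k x where Nk: "0 < k" "k < N" and x: "x \<in> PiE {..v} (\<lambda>_. E)" "inj_on x {..v}"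
    and zero: "lin (coeff (real k / real N)) x = 0"
    using rational_zero_exists[OF v E] .
  \<comment> \<open>The moduli of the entries of \<open>coeff (k / N)\<close>, with denominators
    cleared by the factor N (v - 1).\<close>
  define m where "m = (\<lambda>i. if i = 0 then N * (v - 1) else if i = v then k * (v - 1) else N - k)"
  have split: "{1..v} = insert v {1..<v}"
    using v by auto
  have "(\<Sum>i=1..<v. m i) = (\<Sum>i=1..<v. N - k)"
    by (intro sum.cong) (auto simp: m_def)
  then have "(\<Sum>i=1..v. m i) = (k + (N - k)) * (v - 1)"
    unfolding split using v by (simp add: m_def distrib_right)
  \<comment> \<open>k < N is essential here: only then does subtraction on naturals give k + (N - k)
    = N.\<close>
  then have "m 0 = (\<Sum>i=1..v. m i)"
    using Nk by (simp add: m_def)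
  moreover have "\<forall>i\<le>v. m i \<ge> 1"
    using Nk v by (auto simp: m_def Suc_le_eq)
  moreover have "\<forall>i\<le>v. x i \<in> E" "inj_on x {0..v}"
    using x by (auto simp: PiE_iff atLeast0AtMost)
  moreover have "(\<Sum>i=1..v. real (m i) * x i) = real (m 0) * x 0"
  proof -
    define S where "S = (\<Sum>i=1..<v. x i)"
    have "(\<Sum>i=1..<v. real (m i) * x i) = (\<Sum>i=1..<v. (real N - real k) * x i)"
      using Nk by (intro sum.cong) (auto simp: m_def of_nat_diff)
    then have "(\<Sum>i=1..v. real (m i) * x i) = real k * (real v - 1) * x v + (real N - real k) * S"
      unfolding split S_def using v by (simp add: m_def of_nat_diff sum_distrib_left)
    also have "\<dots> = real N * (real v - 1) * x 0"
    proof -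
      define V where "V = real v - 1"
      have "0 < real N" "0 < V"
        using Nk v by (auto simp: V_def)
      then have "real N * V * (x 0 - (1 - real k / real N) * (S / V) - real k / real N * x v)
          = real N * V * x 0 - (real N - real k) * S - real k * V * x v"
        by (simp add: field_simps)
      moreover have "x 0 - (1 - real k / real N) * (S / V) - real k / real N * x v = 0"
        using zero unfolding lin_coeff[OF v] S_def V_def .
      ultimately have "real N * V * x 0 - (real N - real k) * S - real k * V * x v = 0"
        by simp
      then show ?thesis
        unfolding V_def by linarith
    qed
    finally show ?thesis
      using v by (simp add: m_def of_nat_diff)
  qed
  ultimately show ?thesis
    by (intro that[of m x])
qed

theorem theorem1p2:
  fixes v :: nat and E :: "real set"
  assumes "v \<ge> 2" and "E \<subseteq> {0..1}" and "closed E"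
  shows "(fourier_dim E > ereal (2 / (real v + 1)) \<longleftrightarrow>
            (\<exists>\<beta> \<mu> C. \<beta> > 1 / (real v + 1) \<and> real_distribution \<mu> \<and> supported_on \<mu> E \<and> C > 0 \<and>
               (\<forall>\<xi>. norm (fourier_transform \<mu> \<xi>) \<le> C * (1 + \<bar>\<xi>\<bar>) powr (- \<beta>))))
       \<and> (fourier_dim E > ereal (2 / (real v + 1)) \<longrightarrow>
            (\<exists>f \<in> linear_forms v. contains_nontrivial_zero v E f) \<and>
            (\<exists>(m :: nat \<Rightarrow> nat) (x :: nat \<Rightarrow> real).
               (\<forall>i\<le>v. m i \<ge> 1) \<and> m 0 = (\<Sum>i=1..v. m i) \<and>
               (\<forall>i\<le>v. x i \<in> E) \<and> (\<forall>i\<le>v. \<forall>j\<le>v. i \<noteq> j \<longrightarrow> x i \<noteq> x j) \<and>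
               (\<Sum>i=1..v. real (m i) * x i) = real (m 0) * x 0))"
proof (intro conjI impI)
  show dim_iff: "fourier_dim E > ereal (2 / (real v + 1)) \<longleftrightarrow>
            (\<exists>\<beta> \<mu> C. \<beta> > 1 / (real v + 1) \<and> real_distribution \<mu> \<and> supported_on \<mu> E \<and> C > 0 \<and>
               (\<forall>\<xi>. norm (fourier_transform \<mu> \<xi>) \<le> C * (1 + \<bar>\<xi>\<bar>) powr (- \<beta>)))"
    by (rule fourier_dim_greater_iff[OF assms(1)])
  assume "fourier_dim E > ereal (2 / (real v + 1))"
  then obtain \<beta> \<mu> C where *: "\<beta> > 1 / (real v + 1)" "real_distribution \<mu>" "supported_on \<mu> E" "C > 0"
    and decay: "\<And>\<xi>. norm (fourier_transform \<mu> \<xi>) \<le> C * (1 + \<bar>\<xi>\<bar>) powr (- \<beta>)"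
    unfolding dim_iff by blast
  \<comment> \<open>The bound is even in the frequency, so the opposite sign convention of
    \<open>char\<close> is harmless.\<close>
  have "norm (char \<mu> t) \<le> C * (1 + \<bar>t\<bar>) powr (- \<beta>)" for t
    using decay[of "- t"] by (simp add: fourier_transform_eq_char)
  moreover have "\<beta> * real (Suc v) > 1"
    using *(1) by (simp add: field_simps)
  ultimately interpret fourier_decay \<mu> v \<beta> C
    using *(2,4) by (simp add: fourier_decay_def fourier_decay_axioms_def)
  obtain m x where mx: "\<forall>i\<le>v. m i \<ge> 1" "m 0 = (\<Sum>i=1..v. m i)" "\<forall>i\<le>v. x i \<in> E" "inj_on x {0..v}"
    "(\<Sum>i=1..v. real (m i) * x i) = real (m 0) * x 0"
    using natural_solution_exists[OF assms] *(3) unfolding supported_on_def by blast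
  show "\<exists>f \<in> linear_forms v. contains_nontrivial_zero v E f"
    by (rule linear_form_zeroI[OF mx])
  have "\<forall>i\<le>v. \<forall>j\<le>v. i \<noteq> j \<longrightarrow> x i \<noteq> x j"
    using mx(4) by (auto dest: inj_onD)
  with mx show "\<exists>(m :: nat \<Rightarrow> nat) (x :: nat \<Rightarrow> real).
               (\<forall>i\<le>v. m i \<ge> 1) \<and> m 0 = (\<Sum>i=1..v. m i) \<and>
               (\<forall>i\<le>v. x i \<in> E) \<and> (\<forall>i\<le>v. \<forall>j\<le>v. i \<noteq> j \<longrightarrow> x i \<noteq> x j) \<and>
               (\<Sum>i=1..v. real (m i) * x i) = real (m 0) * x 0"
    by blast
qed

end
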